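(* Let $N$ be a positive integer and let $h>0$, $\varepsilon>0$. Consider the system of ordinary differential equations $$\frac{dU_k}{dt}+\frac{U_k(U_{k+1}-U_{k-1})}{2h}=\varepsilon\,\frac{U_{k+1}-2U_k+U_{k-1}}{h^2},\qquad k=1,2,\dots,N,$$ with periodic boundary conditions $U_{k+N}=U_k$. If the initial data satisfy $U_k(0)>0$ for all $k=1,\dots,N$, then the system possesses a unique solution, which is positive, $U_k(t)>0$ for all $k=1,\dots,N$ and all $t\ge 0$. Moreover, $$\prod_{k=1}^N U_k(t)\ \ge\ \prod_{k=1}^N U_k(0)\qquad\text{for all } t\ge 0,$$ and there is a constant $c$, independent of $k$, such that $U_k(t)\to c$ as $t\to\infty$ for all $k=1,\dots,N$.
   Context: Indices are understood modulo $N$, so $U_0=U_N$ and $U_{N+1}=U_1$. *)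

theory Defs
  imports "HOL-Analysis.Analysis"
begin

text \<open>
  The unknowns are indexed by all integers, and periodicity is part of being a solution;
  the equations and the initial conditions are imposed for \<open>k = 1, ..., N\<close> only.
  On the time interval \<open>J\<close> derivatives are taken relative to \<open>J\<close>, hence one-sided at endpoints
  contained in \<open>J\<close>. Values of \<open>U k\<close> outside \<open>J\<close> are irrelevant.
\<close>

definition solves_system ::
  "nat \<Rightarrow> real \<Rightarrow> real \<Rightarrow> real set \<Rightarrow> (int \<Rightarrow> real \<Rightarrow> real) \<Rightarrow> bool"
where
  "solves_system N h \<epsilon> J U \<longleftrightarrow>
     (\<forall>k. \<forall>t\<in>J. U (k + int N) t = U k t) \<and>
     (\<forall>k\<in>{1..int N}. \<forall>t\<in>J. \<exists>D. (U k has_real_derivative D) (at t within J) \<and>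
        D + U k t * (U (k + 1) t - U (k - 1) t) / (2 * h) =
        \<epsilon> * ((U (k + 1) t - 2 * U k t + U (k - 1) t) / h\<^sup>2))"

definition solves_ivp ::
  "nat \<Rightarrow> real \<Rightarrow> real \<Rightarrow> (int \<Rightarrow> real) \<Rightarrow> real set \<Rightarrow> (int \<Rightarrow> real \<Rightarrow> real) \<Rightarrow> bool"
where
  "solves_ivp N h \<epsilon> u0 J U \<longleftrightarrow>
     solves_system N h \<epsilon> J U \<and> (\<forall>k\<in>{1..int N}. U k 0 = u0 k)"

end

theory Submission
  imports Defs "HOL-Probability.Discrete_Topology"
begin

text \<open>
  Truncating the nonlinearity makes the vector field globally Lipschitz, so a global solution exists
  by Picard's theorem. The sum of the \<open>U k\<close> is conserved, truncated or not; as long as all \<open>U k\<close> are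
  positive they are therefore bounded by that sum and the truncation is inactive. Then the derivative
  of \<open>\<Sum>k. ln (U k)\<close> is \<open>\<epsilon> / h\<^sup>2 * (\<Sum>k. (U (k + 1) - U k)\<^sup>2 / (U k * U (k + 1)))\<close>, which is
  nonnegative. So the product does not decrease, and together with the bounded sum this keeps every
  \<open>U k\<close> away from 0, so positivity is never lost. Since \<open>\<Sum>k. ln (U k)\<close> is also bounded above,
  Barbalat's argument forces \<open>U (k + 1) - U k\<close> to 0, and conservation of the sum identifies the limit
  as the mean of the initial data.
\<close>

section \<open>Calculus on intervals and global solutions of Lipschitz equations\<close>

text \<open>Derivatives are taken within the interval, so one-sided ones at the endpoints suffice.
  Uniqueness, growth of the product and the Barbalat argument all use the mean value theorem in this
  form.\<close>

lemma increment_ge_of_derivative_ge: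
  fixes f :: "real \<Rightarrow> real"
  assumes "a \<le> b"
    and "\<And>t. t \<in> {a..b} \<Longrightarrow> (f has_real_derivative f' t) (at t within {a..b})"
    and "\<And>t. t \<in> {a..b} \<Longrightarrow> m \<le> f' t"
  shows "m * (b - a) \<le> f b - f a"
proof (cases "a = b")
  case False
  with assms(1) have "a < b" by simp
  then obtain x where "x \<in> {a<..<b}" "f b - f a = f' x * (b - a)"
    using mvt_simple[of a b f "\<lambda>t. (*) (f' t)"] assms(2)
    by (auto simp: has_field_derivative_def)
  with assms(3)[of x] \<open>a < b\<close> show ?thesis
    by (simp add: mult_right_mono)
qed simp

lemma has_vector_derivative_integral_atLeast:
  fixes g :: "real \<Rightarrow> 'a::banach"
  assumes "continuous_on {0..} g" and "0 \<le> t"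
  shows "((\<lambda>t. integral {0..t} g) has_vector_derivative g t) (at t within {0..})"
proof -
  \<comment> \<open>Ending at \<open>t + 1\<close> instead of \<open>t\<close> leaves room to the
    right of \<open>t\<close>, so the derivative within this interval is also the one within the
    half-line.\<close>
  have "((\<lambda>t. integral {0..t} g) has_vector_derivative g t) (at t within {0..t + 1})"
    using assms by (intro integral_has_vector_derivative continuous_on_subset[OF assms(1)]) auto
  also have "at t within {0..t + 1} = at t within {0..}"
    by (rule at_within_nhd[where S = "{..<t + 1}"]) auto
  finally show ?thesis .
qed

text \<open>The integral of \<open>B * exp (c * s)\<close> is at most
  \<open>B / c * exp (c * t)\<close>, and the weight cancels the exponential. The bound is uniform
  in \<open>t\<close>; it yields both the boundedness of the Picard operator's values and the
  contraction factor \<open>L / c\<close>.\<close>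

lemma norm_integral_le_exp:
  fixes g :: "real \<Rightarrow> 'a::banach"
  assumes "continuous_on {0..} g" and "0 \<le> t" and "0 < c" and "0 \<le> B"
    and "\<And>s. 0 \<le> s \<Longrightarrow> norm (g s) \<le> B * exp (c * s)"
  shows "norm (exp (- c * t) *\<^sub>R integral {0..t} g) \<le> B / c"
proof -
  have "((\<lambda>s. B * exp (c * s)) has_integral (B / c * exp (c * t) - B / c * exp (c * 0))) {0..t}"
    using assms(2,3)
    by (intro fundamental_theorem_of_calculus)
       (auto intro!: derivative_eq_intros simp flip: has_real_derivative_iff_has_vector_derivative)
  moreover have "norm (integral {0..t} g) \<le> integral {0..t} (\<lambda>s. B * exp (c * s))"
    using assms
    by (intro Henstock_Kurzweil_Integration.integral_norm_bound_integral)
       (auto intro!: integrable_continuous_interval continuous_on_subset[OF assms(1)] continuous_intros)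
  ultimately have "norm (integral {0..t} g) \<le> B / c * exp (c * t) - B / c * exp (c * 0)"
    by (metis integral_unique)
  also have "\<dots> \<le> B / c * exp (c * t)" using assms by simp
  finally show ?thesis using assms by (simp add: exp_minus field_simps)
qed

text \<open>
  Banach's fixed point theorem applied to \<open>y t = exp (- c * t) *\<^sub>R x t\<close>: for \<open>c > L\<close> the weight
  makes the Picard operator a contraction on the whole half-line, so no gluing of local solutions
  is needed.
\<close>

lemma lipschitz_imp_global_solution:
  fixes f :: "'a::banach \<Rightarrow> 'a"
  assumes f: "L-lipschitz_on UNIV f"
  obtains x where "x 0 = a"
    and "\<And>t. 0 \<le> t \<Longrightarrow> (x has_vector_derivative f (x t)) (at t within {0..})"
proof -
  have L: "0 \<le> L" and fL: "norm (f y - f z) \<le> L * norm (y - z)" for y z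
    using f by (auto simp: lipschitz_on_def dist_norm)
  \<comment> \<open>Any \<open>c > L\<close> works; the summand 1 covers
    \<open>L = 0\<close>.\<close>
  define c where "c = 2 * L + 1"
  have c: "0 < c" "L / c < 1" "0 \<le> L / c" using L by (auto simp: c_def)
  \<comment> \<open>\<open>g y\<close> is the integrand of Picard's equation expressed through the
    weighted unknown \<open>y\<close>, and \<open>P y\<close> is the weighted right-hand side whose
    fixed point is sought.\<close>
  define g where "g y s = f (exp (c * s) *\<^sub>R apply_bcontfun y s)" for y :: "real \<Rightarrow>\<^sub>C 'a" and s
  define P where "P y t = exp (- c * t) *\<^sub>R (a + integral {0..t} (g y))" for y t
  have f_cont: "continuous_on UNIV f" using f by (rule lipschitz_on_continuous_on)
  have g_cont: "continuous_on A (g y)" for A y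
    unfolding g_def by (intro continuous_intros continuous_on_compose2[OF f_cont]) auto
  have g_diff: "norm (g y s - g z s) \<le> L * norm (y - z) * exp (c * s)" for y z s
  proof -
    have "norm (g y s - g z s) \<le> L * norm (exp (c * s) *\<^sub>R apply_bcontfun (y - z) s)"
      unfolding g_def by (rule order_trans[OF fL]) (simp add: algebra_simps)
    also have "\<dots> \<le> L * (exp (c * s) * norm (y - z))"
      using L norm_bounded[of "y - z" s] by (intro mult_left_mono) auto
    finally show ?thesis by (simp add: ac_simps)
  qed
  have deriv: "((\<lambda>t. integral {0..t} (g y)) has_vector_derivative g y t) (at t within {0..})"
    if "0 \<le> t" for y t
    using g_cont that by (rule has_vector_derivative_integral_atLeast)
  have I_cont: "continuous_on {0..} (\<lambda>t. integral {0..t} (g y))" for y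
    by (rule differentiable_imp_continuous_on)
       (use deriv in \<open>auto simp: differentiable_on_def intro!: differentiableI_vector\<close>)
  \<comment> \<open>Elements of \<open>bcontfun\<close> are defined on the whole line;
    \<open>max 0 t\<close> extends \<open>P y\<close> to negative times by its value at 0.\<close>
  have P_bcontfun: "(\<lambda>t. P y (max 0 t)) \<in> bcontfun" for y
  proof (rule bcontfun_normI)
    show "continuous_on UNIV (\<lambda>t. P y (max 0 t))"
      unfolding P_def by (intro continuous_intros continuous_on_compose2[OF I_cont]) auto
    fix t
    define s where "s = max (0::real) t"
    have s: "0 \<le> s" by (simp add: s_def)
    \<comment> \<open>\<open>g 0\<close> is constantly \<open>f 0\<close>, so the Lipschitz estimate
      against \<open>0\<close> controls the growth of \<open>g y\<close>.\<close>
    have "norm (g y r) \<le> (norm (f 0) + L * norm y) * exp (c * r)" if "0 \<le> r" for r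
    proof -
      have "norm (g y r) \<le> norm (f 0) + norm (g y r - g 0 r)"
        using norm_triangle_sub[of "g y r" "g 0 r"] by (simp add: g_def)
      also have "\<dots> \<le> norm (f 0) * exp (c * r) + L * norm (y - 0) * exp (c * r)"
        using that c by (intro add_mono g_diff) (auto simp: mult_le_cancel_left1)
      finally show ?thesis by (simp add: algebra_simps)
    qed
    then have "norm (exp (- c * s) *\<^sub>R integral {0..s} (g y)) \<le> (norm (f 0) + L * norm y) / c"
      using s c L by (intro norm_integral_le_exp g_cont) auto
    moreover have "norm (exp (- c * s) *\<^sub>R a) \<le> norm a"
      using s c by (simp add: mult_left_le_one_le)
    ultimately show "norm (P y (max 0 t)) \<le> norm a + (norm (f 0) + L * norm y) / c"
      unfolding P_def s_def[symmetric] scaleR_add_right by (rule norm_triangle_mono[rotated])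
  qed
  define T where "T y = Bcontfun (\<lambda>t. P y (max 0 t))" for y
  have T_apply: "apply_bcontfun (T y) t = P y (max 0 t)" for y t
    unfolding T_def using P_bcontfun by (simp add: Bcontfun_inverse)
  have "dist (T y) (T z) \<le> L / c * dist y z" for y z
  proof (rule dist_bound)
    fix t
    define s where "s = max (0::real) t"
    have s: "0 \<le> s" by (simp add: s_def)
    have int: "g y integrable_on {0..s}" for y
      by (intro integrable_continuous_interval g_cont)
    have "P y s - P z s = exp (- c * s) *\<^sub>R integral {0..s} (\<lambda>r. g y r - g z r)"
      unfolding P_def by (simp add: integral_diff[OF int int] algebra_simps)
    also have "norm \<dots> \<le> L * norm (y - z) / c"
      using s c L by (intro norm_integral_le_exp g_diff continuous_on_diff g_cont) auto
    finally show "dist (apply_bcontfun (T y) t) (apply_bcontfun (T z) t) \<le> L / c * dist y z"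
      by (simp add: T_apply s_def dist_norm)
  qed
  then obtain y where y: "T y = y"
    using banach_fix_type[of "L / c" T] c by blast
  define x where "x t = a + integral {0..t} (g y)" for t
  have x_eq: "x t = exp (c * t) *\<^sub>R apply_bcontfun y t" if "0 \<le> t" for t
    using T_apply[of y t] that unfolding y P_def x_def by (simp flip: exp_add)
  show thesis
  proof
    show "x 0 = a" by (simp add: x_def)
    fix t :: real assume "0 \<le> t"
    then have "(x has_vector_derivative g y t) (at t within {0..})"
      unfolding x_def by (auto intro!: derivative_eq_intros deriv)
    moreover have "g y t = f (x t)"
      using \<open>0 \<le> t\<close> by (simp add: g_def x_eq)
    ultimately show "(x has_vector_derivative f (x t)) (at t within {0..})" by simp
  qed
qed

section \<open>Periodic sequences indexed by the integers\<close>

lemma periodic_add_multiple: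
  fixes a :: "int \<Rightarrow> 'a"
  assumes "\<And>k. a (k + p) = a k"
  shows "a (k + m * p) = a k"
proof (induction m rule: int_induct[where k = 0])
  case (step1 i)
  then show ?case using assms[of "k + i * p"] by (simp add: algebra_simps)
next
  case (step2 i)
  then show ?case using assms[of "k + (i - 1) * p"] by (simp add: algebra_simps)
qed simp

lemma periodic_mod:
  fixes a :: "int \<Rightarrow> 'a"
  assumes "\<And>k. a (k + p) = a k"
  shows "a (k mod p) = a k"
  using periodic_add_multiple[of a p "k mod p" "k div p"] assms by simp

text \<open>\<open>(k - 1) mod p + 1\<close> is the representative of \<open>k\<close> in
  \<open>{1..p}\<close>, the range in which the equations are imposed. Facts known there are carried
  to all indices in this way.\<close>

lemma periodic_reduce:
  fixes a :: "int \<Rightarrow> 'a"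
  assumes "\<And>k. a (k + p) = a k"
  shows "a ((k - 1) mod p + 1) = a k"
proof -
  have "a (k + p + 1) = a (k + 1)" for k
    using assms[of "k + 1"] by (simp add: ac_simps)
  then show ?thesis using periodic_mod[of "\<lambda>k. a (k + 1)" p "k - 1"] by simp
qed

lemma mod_plus_one_in_period: "0 < p \<Longrightarrow> (k - 1) mod p + 1 \<in> {1..p}" for p k :: int
  by (simp add: add1_zle_eq)

text \<open>The shift loses the term at 1 and gains the equal term at \<open>int N + 1\<close>. This
  takes the place of summation by parts in the conservation and dissipation identities.\<close>

lemma sum_periodic_shift:
  fixes a :: "int \<Rightarrow> 'a::comm_monoid_add"
  assumes "\<And>k. a (k + int N) = a k"
  shows "(\<Sum>k\<in>{1..int N}. a (k + 1)) = (\<Sum>k\<in>{1..int N}. a k)"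
proof (cases "N = 0")
  case False
  have "(\<Sum>k\<in>{1..int N}. a (k + 1)) = (\<Sum>k\<in>{2..int N + 1}. a k)"
    by (rule sum.reindex_bij_witness[of _ "\<lambda>k. k - 1" "\<lambda>k. k + 1"]) auto
  also have "{2..int N + 1} = insert (int N + 1) {2..int N}" using False by auto
  also have "sum a \<dots> = sum a (insert 1 {2..int N})"
    using assms[of 1] by (simp add: add.commute)
  also have "insert 1 {2..int N} = {1..int N}" using False by auto
  finally show ?thesis .
qed simp

lemma sum_periodic_shift_minus:
  fixes a :: "int \<Rightarrow> 'a::comm_monoid_add"
  assumes "\<And>k. a (k + int N) = a k"
  shows "(\<Sum>k\<in>{1..int N}. a (k - 1)) = (\<Sum>k\<in>{1..int N}. a k)"
proof -
  have "a (k + int N - 1) = a (k - 1)" for k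
    using assms[of "k - 1"] by (simp add: algebra_simps)
  then show ?thesis using sum_periodic_shift[of "\<lambda>k. a (k - 1)" N] by simp
qed

text \<open>Every factor other than \<open>x j\<close> is at most the whole sum. Read backwards, a
  lower bound on the product and an upper bound on the sum keep each entry away from 0.\<close>

lemma prod_le_mult_sum_power:
  fixes x :: "'a \<Rightarrow> real"
  assumes "finite A" "j \<in> A" "\<And>k. k \<in> A \<Longrightarrow> 0 \<le> x k"
  shows "prod x A \<le> x j * sum x A ^ (card A - 1)"
proof -
  have "prod x (A - {j}) \<le> (\<Prod>k\<in>A - {j}. sum x A)"
    using assms by (intro prod_mono) (auto intro!: member_le_sum)
  also have "\<dots> = sum x A ^ (card A - 1)"
    using assms by simp
  finally show ?thesis
    using assms by (simp add: prod.remove[of A j] mult_left_mono)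
qed

section \<open>Barbalat's argument\<close>

text \<open>\<open>G\<close> increases and is bounded, so after some time \<open>T\<close> it stays
  within \<kappa> of its supremum. If \<open>Q\<close> reached \<eta> later, the lower bound on its
  slope would keep it above \<eta>/2 long enough for \<open>G\<close> to gain \<kappa>, a
  contradiction.\<close>

lemma barbalat_tendsto_zero:
  fixes G Q :: "real \<Rightarrow> real"
  assumes G: "\<And>t. 0 \<le> t \<Longrightarrow> (G has_real_derivative G' t) (at t within {0..})"
    and Q: "\<And>t. 0 \<le> t \<Longrightarrow> (Q has_real_derivative Q' t) (at t within {0..})"
    and G': "\<And>t. 0 \<le> t \<Longrightarrow> c * Q t \<le> G' t" and "0 < c"
    and Q0: "\<And>t. 0 \<le> t \<Longrightarrow> 0 \<le> Q t"
    and Q': "\<And>t. 0 \<le> t \<Longrightarrow> - M \<le> Q' t" and "0 < M"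
    and bound: "\<And>t. 0 \<le> t \<Longrightarrow> G t \<le> B"
  shows "(Q \<longlongrightarrow> 0) at_top"
proof (rule order_tendstoI)
  fix a :: real
  assume "a < 0"
  then show "eventually (\<lambda>t. a < Q t) at_top"
    using Q0 by (intro eventually_at_top_linorderI[of 0]) (meson less_le_trans)
next
  fix \<eta> :: real
  assume \<eta>: "0 < \<eta>"
  have G_incr: "m * (t - s) \<le> G t - G s"
    if "0 \<le> s" "s \<le> t" "\<And>r. r \<in> {s..t} \<Longrightarrow> m \<le> G' r" for m s t
    using that by (intro increment_ge_of_derivative_ge[where f' = G'] has_field_derivative_subset[OF G]) auto
  have G_mono: "G s \<le> G t" if "0 \<le> s" "s \<le> t" for s t
  proof -
    have "0 \<le> G' r" if "0 \<le> r" for r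
      using G'[OF that] Q0[OF that] \<open>0 < c\<close> by (smt (verit) mult_nonneg_nonneg)
    then show ?thesis using G_incr[of s t 0] that by simp
  qed
  \<comment> \<open>With slope at least \<open>- M\<close>, \<open>Q\<close> needs at least the time
    \<open>d\<close> to fall from \<eta> to \<eta>/2; meanwhile \<open>G\<close> gains at least
    \<kappa>.\<close>
  define d where "d = \<eta> / (2 * M)"
  have d: "0 < d" using \<eta> \<open>0 < M\<close> by (simp add: d_def)
  define \<kappa> where "\<kappa> = c * (\<eta> / 2) * d"
  have \<kappa>: "0 < \<kappa>" using \<eta> d \<open>0 < c\<close> by (simp add: \<kappa>_def)
  have bdd: "bdd_above (G ` {0..})" using bound by (auto intro!: bdd_aboveI[of _ B])
  obtain T where T: "0 \<le> T" "Sup (G ` {0..}) - \<kappa> < G T"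
    using less_cSupD[of "G ` {0..}" "Sup (G ` {0..}) - \<kappa>"] \<kappa> by auto
  have "Q t < \<eta>" if "T \<le> t" for t
  proof (rule ccontr)
    assume "\<not> Q t < \<eta>"
    have t: "0 \<le> t" using that T by simp
    have "c * (\<eta> / 2) \<le> G' s" if s: "s \<in> {t..t + d}" for s
    proof -
      have "- M * (s - t) \<le> Q s - Q t"
        using s t Q' by (intro increment_ge_of_derivative_ge[where f' = Q'] has_field_derivative_subset[OF Q]) auto
      moreover have "M * (s - t) \<le> M * d" using s \<open>0 < M\<close> by (intro mult_left_mono) auto
      moreover have "M * d = \<eta> / 2" using \<open>0 < M\<close> by (simp add: d_def)
      ultimately have "\<eta> / 2 \<le> Q s" using \<open>\<not> Q t < \<eta>\<close> by simp
      then have "c * (\<eta> / 2) \<le> c * Q s" using \<open>0 < c\<close> by simp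
      also have "\<dots> \<le> G' s" using s t by (intro G') auto
      finally show ?thesis .
    qed
    then have "\<kappa> \<le> G (t + d) - G t"
      using G_incr[of t "t + d" "c * (\<eta> / 2)"] t d by (simp add: \<kappa>_def)
    moreover have "G (t + d) \<le> Sup (G ` {0..})" using t d by (intro cSup_upper bdd) auto
    moreover have "G T \<le> G t" using T that by (intro G_mono)
    ultimately show False using T by simp
  qed
  then show "eventually (\<lambda>t. Q t < \<eta>) at_top"
    by (auto simp: eventually_at_top_linorder)
qed

section \<open>The right-hand side of the system and its algebraic identities\<close>

text \<open>\<open>a\<close>, \<open>b\<close>, \<open>c\<close> are the values at the left
  neighbour, the site and the right neighbour. The truncation \<phi> acts only on the nonlinear
  term, factor by factor; the identity gives the original system.\<close>

definition lattice_rhs :: "real \<Rightarrow> real \<Rightarrow> (real \<Rightarrow> real) \<Rightarrow> real \<Rightarrow> real \<Rightarrow> real \<Rightarrow> real" where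
  "lattice_rhs h \<epsilon> \<phi> a b c =
     \<epsilon> * ((c - 2 * b + a) / h\<^sup>2) - \<phi> b * (\<phi> c - \<phi> a) / (2 * h)"

text \<open>The difference of products is split so that just \<open>\<phi> a\<close>,
  \<open>\<phi> c\<close> and \<open>\<phi> b'\<close> remain as cofactors. One estimate thus serves
  the identity along bounded solutions and a bounded truncation on the whole space.\<close>

lemma lattice_rhs_diff_le:
  assumes "0 < h" "0 < \<epsilon>" and lip: "\<And>x y. \<bar>\<phi> x - \<phi> y\<bar> \<le> \<bar>x - y\<bar>"
    and M: "\<bar>\<phi> a\<bar> \<le> M" "\<bar>\<phi> c\<bar> \<le> M" "\<bar>\<phi> b'\<bar> \<le> M"
  shows "\<bar>lattice_rhs h \<epsilon> \<phi> a b c - lattice_rhs h \<epsilon> \<phi> a' b' c'\<bar>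
    \<le> (M / h + 2 * \<epsilon> / h\<^sup>2) * (\<bar>a - a'\<bar> + \<bar>b - b'\<bar> + \<bar>c - c'\<bar>)"
proof -
  let ?D = "\<bar>a - a'\<bar> + \<bar>b - b'\<bar> + \<bar>c - c'\<bar>"
  have M0: "0 \<le> M" using M(1) by simp
  have "\<bar>\<phi> b * (\<phi> c - \<phi> a) - \<phi> b' * (\<phi> c' - \<phi> a')\<bar>
      = \<bar>(\<phi> b - \<phi> b') * (\<phi> c - \<phi> a) + \<phi> b' * ((\<phi> c - \<phi> c') - (\<phi> a - \<phi> a'))\<bar>"
    by (simp add: algebra_simps)
  also have "\<dots> \<le> \<bar>\<phi> b - \<phi> b'\<bar> * \<bar>\<phi> c - \<phi> a\<bar> + \<bar>\<phi> b'\<bar> * \<bar>(\<phi> c - \<phi> c') - (\<phi> a - \<phi> a')\<bar>"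
    by (metis abs_mult abs_triangle_ineq)
  also have "\<dots> \<le> \<bar>b - b'\<bar> * (2 * M) + M * (\<bar>c - c'\<bar> + \<bar>a - a'\<bar>)"
    using M lip[of b b'] lip[of c c'] lip[of a a'] by (intro add_mono mult_mono) linarith+
  also have "\<dots> \<le> 2 * M * ?D"
    using mult_nonneg_nonneg[OF M0 abs_ge_zero[of "a - a'"]]
      mult_nonneg_nonneg[OF M0 abs_ge_zero[of "c - c'"]] by (simp add: algebra_simps)
  finally have "\<bar>\<phi> b * (\<phi> c - \<phi> a) - \<phi> b' * (\<phi> c' - \<phi> a')\<bar> / (2 * h) \<le> 2 * M * ?D / (2 * h)"
    using \<open>0 < h\<close> by (intro divide_right_mono) auto
  then have 1: "\<bar>\<phi> b * (\<phi> c - \<phi> a) / (2 * h) - \<phi> b' * (\<phi> c' - \<phi> a') / (2 * h)\<bar> \<le> M / h * ?D"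
    using \<open>0 < h\<close> by (simp flip: diff_divide_distrib)
  have "\<bar>\<epsilon> / h\<^sup>2 * ((c - 2 * b + a) - (c' - 2 * b' + a'))\<bar>
      = \<epsilon> / h\<^sup>2 * \<bar>(c - 2 * b + a) - (c' - 2 * b' + a')\<bar>"
    using \<open>0 < \<epsilon>\<close> by (simp add: abs_mult)
  also have "\<dots> \<le> \<epsilon> / h\<^sup>2 * (2 * ?D)"
    using \<open>0 < \<epsilon>\<close> by (intro mult_left_mono; smt (verit) divide_nonneg_nonneg zero_le_power2)
  also have "\<dots> = 2 * \<epsilon> / h\<^sup>2 * ?D" by simp
  also have "\<epsilon> / h\<^sup>2 * (x - y) = \<epsilon> * (x / h\<^sup>2) - \<epsilon> * (y / h\<^sup>2)" for x y
    by (simp add: diff_divide_distrib right_diff_distrib)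
  finally have 2: "\<bar>\<epsilon> * ((c - 2 * b + a) / h\<^sup>2) - \<epsilon> * ((c' - 2 * b' + a') / h\<^sup>2)\<bar>
      \<le> 2 * \<epsilon> / h\<^sup>2 * ?D" .
  have "lattice_rhs h \<epsilon> \<phi> a b c - lattice_rhs h \<epsilon> \<phi> a' b' c'
      = (\<epsilon> * ((c - 2 * b + a) / h\<^sup>2) - \<epsilon> * ((c' - 2 * b' + a') / h\<^sup>2))
        - (\<phi> b * (\<phi> c - \<phi> a) / (2 * h) - \<phi> b' * (\<phi> c' - \<phi> a') / (2 * h))"
    by (simp add: lattice_rhs_def)
  then show ?thesis unfolding distrib_right using 1 2 by linarith
qed

text \<open>The nonlinear term is a difference of the flux
  \<open>\<phi> (u k) * \<phi> (u (k + 1))\<close> across neighbouring bonds and the diffusion is a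
  second difference; both cancel over a period. Truncating factor by factor preserves this
  structure.\<close>

lemma sum_lattice_rhs:
  fixes u :: "int \<Rightarrow> real"
  assumes "\<And>k. u (k + int N) = u k"
  shows "(\<Sum>k\<in>{1..int N}. lattice_rhs h \<epsilon> \<phi> (u (k - 1)) (u k) (u (k + 1))) = 0"
proof -
  have per: "u (1 + (k + int N)) = u (1 + k)" "u (k + int N - 1) = u (k - 1)" for k
    using assms[of "1 + k"] assms[of "k - 1"] by (simp_all add: algebra_simps)
  have "(\<Sum>k\<in>{1..int N}. \<phi> (u k) * \<phi> (u (k - 1))) = (\<Sum>k\<in>{1..int N}. \<phi> (u k) * \<phi> (u (k + 1)))"
    using sum_periodic_shift_minus[of "\<lambda>k. \<phi> (u (1 + k)) * \<phi> (u k)" N] assms per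
    by (simp add: ac_simps)
  moreover have "(\<Sum>k\<in>{1..int N}. u (k + 1)) = (\<Sum>k\<in>{1..int N}. u k)"
      "(\<Sum>k\<in>{1..int N}. u (k - 1)) = (\<Sum>k\<in>{1..int N}. u k)"
    using assms by (intro sum_periodic_shift sum_periodic_shift_minus; simp)+
  ultimately show ?thesis
    unfolding lattice_rhs_def
    by (simp add: sum_subtractf sum.distrib right_diff_distrib
        flip: sum_distrib_left sum_divide_distrib)
qed

text \<open>Division by \<open>u k\<close> makes the advection linear, so it cancels over a period.
  Diffusion leaves two ratios; shifting \<open>u (k - 1) / u k\<close> makes it the reciprocal of
  \<open>u (k + 1) / u k\<close>, and \<open>x + 1 / x - 2\<close> equals
  \<open>(x - 1)\<^sup>2 / x\<close>.\<close>

lemma sum_lattice_rhs_divide: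
  fixes u :: "int \<Rightarrow> real"
  assumes per: "\<And>k. u (k + int N) = u k" and pos: "\<And>k. 0 < u k" and "0 < h"
  shows "(\<Sum>k\<in>{1..int N}. lattice_rhs h \<epsilon> (\<lambda>x. x) (u (k - 1)) (u k) (u (k + 1)) / u k)
    = \<epsilon> / h\<^sup>2 * (\<Sum>k\<in>{1..int N}. (u (k + 1) - u k)\<^sup>2 / (u k * u (k + 1)))"
proof -
  have nz: "u k \<noteq> 0" for k using pos[of k] by simp
  have per': "u (k + int N + 1) = u (k + 1)" for k
    using per[of "k + 1"] by (simp add: algebra_simps)
  have "lattice_rhs h \<epsilon> (\<lambda>x. x) (u (k - 1)) (u k) (u (k + 1)) / u k
      = \<epsilon> / h\<^sup>2 * (u (k + 1) / u k - 2 + u (k - 1) / u k) - (u (k + 1) - u (k - 1)) / (2 * h)" for k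
    using nz[of k] \<open>0 < h\<close> unfolding lattice_rhs_def by (simp add: field_simps)
  moreover have "(\<Sum>k\<in>{1..int N}. u (k + 1)) = (\<Sum>k\<in>{1..int N}. u k)"
      "(\<Sum>k\<in>{1..int N}. u (k - 1)) = (\<Sum>k\<in>{1..int N}. u k)"
    using per by (intro sum_periodic_shift sum_periodic_shift_minus; simp)+
  moreover have "(\<Sum>k\<in>{1..int N}. u (k - 1) / u k) = (\<Sum>k\<in>{1..int N}. u k / u (k + 1))"
    using sum_periodic_shift_minus[of "\<lambda>k. u k / u (k + 1)" N] per per' by simp
  ultimately have "(\<Sum>k\<in>{1..int N}. lattice_rhs h \<epsilon> (\<lambda>x. x) (u (k - 1)) (u k) (u (k + 1)) / u k)
      = \<epsilon> / h\<^sup>2 * (\<Sum>k\<in>{1..int N}. u (k + 1) / u k - 2 + u k / u (k + 1))"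
    by (simp add: sum_subtractf sum.distrib flip: sum_distrib_left sum_divide_distrib)
  moreover have "u (k + 1) / u k - 2 + u k / u (k + 1) = (u (k + 1) - u k)\<^sup>2 / (u k * u (k + 1))" for k
    using nz[of k] nz[of "k + 1"] by (simp add: field_simps power2_eq_square)
  ultimately show ?thesis by simp
qed

section \<open>Uniqueness\<close>

lemma solves_system_iff:
  "solves_system N h \<epsilon> J U \<longleftrightarrow>
     (\<forall>k. \<forall>t\<in>J. U (k + int N) t = U k t) \<and>
     (\<forall>k\<in>{1..int N}. \<forall>t\<in>J. (U k has_real_derivative
        lattice_rhs h \<epsilon> (\<lambda>x. x) (U (k - 1) t) (U k t) (U (k + 1) t)) (at t within J))"
proof -
  have "(\<exists>D. P D \<and> D + r = s) \<longleftrightarrow> P (s - r)" for P and r s :: real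
    by (metis add_diff_cancel diff_add_cancel)
  then show ?thesis by (simp add: solves_system_def lattice_rhs_def)
qed

lemma solves_system_subset:
  assumes "solves_system N h \<epsilon> J U" "I \<subseteq> J"
  shows "solves_system N h \<epsilon> I U"
  using assms unfolding solves_system_iff by (meson has_field_derivative_subset subsetD)

lemma periodic_family_bounded:
  fixes U :: "int \<Rightarrow> real \<Rightarrow> real"
  assumes "0 < N" and per: "\<And>k t. t \<in> {a..b} \<Longrightarrow> U (k + int N) t = U k t"
    and cont: "\<And>k. k \<in> {1..int N} \<Longrightarrow> continuous_on {a..b} (U k)"
  obtains M where "\<And>k t. t \<in> {a..b} \<Longrightarrow> \<bar>U k t\<bar> \<le> M"
proof -
  have "bounded (\<Union>k\<in>{1..int N}. U k ` {a..b})"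
    using cont by (intro bounded_UN ballI compact_imp_bounded compact_continuous_image) auto
  then obtain M where M: "\<And>k t. k \<in> {1..int N} \<Longrightarrow> t \<in> {a..b} \<Longrightarrow> \<bar>U k t\<bar> \<le> M"
    unfolding bounded_iff by (metis UN_I imageI real_norm_def)
  have "\<bar>U k t\<bar> \<le> M" if "t \<in> {a..b}" for k t
    using M[OF mod_plus_one_in_period[of "int N" k] that] \<open>0 < N\<close>
      periodic_reduce[of "\<lambda>k. U k t" "int N" k] per[OF that] by simp
  then show thesis by (rule that)
qed

text \<open>Gronwall's argument for the sum \<open>W\<close> of squared differences: on a compact
  interval both solutions are bounded, so the right-hand side is Lipschitz along them and
  \<open>W\<close> grows at most at rate \<open>6 * K\<close>. Starting from 0, it stays 0.\<close>

lemma solves_system_unique: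
  assumes "0 < N" "0 < h" "0 < \<epsilon>" "0 \<le> b"
    and U: "solves_system N h \<epsilon> {0..b} U" and V: "solves_system N h \<epsilon> {0..b} V"
    and init: "\<And>k. k \<in> {1..int N} \<Longrightarrow> U k 0 = V k 0"
  shows "U k b = V k b"
proof -
  let ?F = "lattice_rhs h \<epsilon> (\<lambda>x. x)"
  note sol = U[unfolded solves_system_iff] V[unfolded solves_system_iff]
  have per: "U (k + int N) t = U k t" "V (k + int N) t = V k t" if "t \<in> {0..b}" for k t
    using sol that by blast+
  have deriv: "(U k has_real_derivative ?F (U (k - 1) t) (U k t) (U (k + 1) t)) (at t within {0..b})"
    "(V k has_real_derivative ?F (V (k - 1) t) (V k t) (V (k + 1) t)) (at t within {0..b})"
    if "k \<in> {1..int N}" "t \<in> {0..b}" for k t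
    using sol that by blast+
  obtain MU where MU: "\<And>k t. t \<in> {0..b} \<Longrightarrow> \<bar>U k t\<bar> \<le> MU"
    using periodic_family_bounded[of N 0 b U] \<open>0 < N\<close> per DERIV_continuous_on[OF deriv(1)] by blast
  obtain MV where MV: "\<And>k t. t \<in> {0..b} \<Longrightarrow> \<bar>V k t\<bar> \<le> MV"
    using periodic_family_bounded[of N 0 b V] \<open>0 < N\<close> per DERIV_continuous_on[OF deriv(2)] by blast
  define M where "M = max MU MV"
  define K where "K = M / h + 2 * \<epsilon> / h\<^sup>2"
  have "0 \<le> M"
    using MU[of 0 1] \<open>0 \<le> b\<close> by (auto simp: M_def)
  then have K: "0 \<le> K" using \<open>0 < h\<close> \<open>0 < \<epsilon>\<close> by (simp add: K_def)
  define D where "D k t = U k t - V k t" for k t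
  define F where "F k t = ?F (U (k - 1) t) (U k t) (U (k + 1) t) - ?F (V (k - 1) t) (V k t) (V (k + 1) t)"
    for k t
  define W where "W t = (\<Sum>k\<in>{1..int N}. (D k t)\<^sup>2)" for t
  \<comment> \<open>Each of the two mixed products costs one square of \<open>D k t\<close>, and the
    product of \<open>D k t\<close> with itself gives two more: hence the 4.\<close>
  have F_le: "2 * D k t * F k t \<le> K * ((D (k - 1) t)\<^sup>2 + 4 * (D k t)\<^sup>2 + (D (k + 1) t)\<^sup>2)"
    if "t \<in> {0..b}" for k t
  proof -
    have "\<bar>F k t\<bar> \<le> K * (\<bar>D (k - 1) t\<bar> + \<bar>D k t\<bar> + \<bar>D (k + 1) t\<bar>)"
      unfolding F_def D_def K_def
      using MU[OF that] MV[OF that] \<open>0 < h\<close> \<open>0 < \<epsilon>\<close>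
      by (intro lattice_rhs_diff_le) (auto simp: M_def le_max_iff_disj)
    then have "2 * \<bar>D k t\<bar> * \<bar>F k t\<bar>
        \<le> 2 * \<bar>D k t\<bar> * (K * (\<bar>D (k - 1) t\<bar> + \<bar>D k t\<bar> + \<bar>D (k + 1) t\<bar>))"
      by (intro mult_left_mono) auto
    also have "\<dots> = K * (2 * \<bar>D k t\<bar> * \<bar>D (k - 1) t\<bar> + 2 * (\<bar>D k t\<bar> * \<bar>D k t\<bar>) + 2 * \<bar>D k t\<bar> * \<bar>D (k + 1) t\<bar>)"
      by (simp add: algebra_simps)
    also have "\<dots> \<le> K * ((D (k - 1) t)\<^sup>2 + 4 * (D k t)\<^sup>2 + (D (k + 1) t)\<^sup>2)"
    proof (rule mult_left_mono[OF _ K])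
      show "2 * \<bar>D k t\<bar> * \<bar>D (k - 1) t\<bar> + 2 * (\<bar>D k t\<bar> * \<bar>D k t\<bar>) + 2 * \<bar>D k t\<bar> * \<bar>D (k + 1) t\<bar>
          \<le> (D (k - 1) t)\<^sup>2 + 4 * (D k t)\<^sup>2 + (D (k + 1) t)\<^sup>2"
        using sum_squares_bound[of "\<bar>D k t\<bar>" "\<bar>D (k - 1) t\<bar>"] sum_squares_bound[of "\<bar>D k t\<bar>" "\<bar>D (k + 1) t\<bar>"]
        by (simp add: power2_eq_square)
    qed
    also have "2 * \<bar>D k t\<bar> * \<bar>F k t\<bar> = \<bar>2 * D k t * F k t\<bar>" by (simp add: abs_mult)
    finally show ?thesis by linarith
  qed
  \<comment> \<open>By periodicity both shifted sums equal \<open>W t\<close>, and 1 + 4 + 1 =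
    6.\<close>
  have W_le: "(\<Sum>k\<in>{1..int N}. 2 * D k t * F k t) \<le> 6 * K * W t" if "t \<in> {0..b}" for t
  proof -
    have "(\<Sum>k\<in>{1..int N}. (D (k - 1) t)\<^sup>2) = W t" "(\<Sum>k\<in>{1..int N}. (D (k + 1) t)\<^sup>2) = W t"
      unfolding W_def using per[OF that]
      by (intro sum_periodic_shift[of "\<lambda>k. (D k t)\<^sup>2"] sum_periodic_shift_minus[of "\<lambda>k. (D k t)\<^sup>2"];
          simp add: D_def)+
    moreover have "(\<Sum>k\<in>{1..int N}. 2 * D k t * F k t)
        \<le> (\<Sum>k\<in>{1..int N}. K * ((D (k - 1) t)\<^sup>2 + 4 * (D k t)\<^sup>2 + (D (k + 1) t)\<^sup>2))"
      by (intro sum_mono F_le that)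
    ultimately show ?thesis
      by (simp add: sum.distrib W_def flip: sum_distrib_left)
  qed
  have W_deriv: "(W has_real_derivative (\<Sum>k\<in>{1..int N}. 2 * D k t * F k t)) (at t within {0..b})"
    if "t \<in> {0..b}" for t
    unfolding W_def D_def F_def using that
    by (auto intro!: derivative_eq_intros deriv sum.cong simp: algebra_simps)
  \<comment> \<open>The weighted \<open>W\<close> is nonincreasing; its sign is reversed because the
    mean value lemma bounds increments from below.\<close>
  have "0 * (b - 0) \<le> - (exp (- (6 * K * b)) * W b) - - (exp (- (6 * K * 0)) * W 0)"
  proof (rule increment_ge_of_derivative_ge[where f = "\<lambda>t. - (exp (- (6 * K * t)) * W t)"
        and f' = "\<lambda>t. exp (- (6 * K * t)) * (6 * K * W t - (\<Sum>k\<in>{1..int N}. 2 * D k t * F k t))"])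
    fix t assume "t \<in> {0..b}"
    then show "((\<lambda>t. - (exp (- (6 * K * t)) * W t)) has_real_derivative
        exp (- (6 * K * t)) * (6 * K * W t - (\<Sum>k\<in>{1..int N}. 2 * D k t * F k t))) (at t within {0..b})"
      by (auto intro!: derivative_eq_intros W_deriv simp: algebra_simps)
    show "0 \<le> exp (- (6 * K * t)) * (6 * K * W t - (\<Sum>k\<in>{1..int N}. 2 * D k t * F k t))"
      using W_le \<open>t \<in> {0..b}\<close> by simp
  qed (use \<open>0 \<le> b\<close> in simp)
  moreover have "W 0 = 0" unfolding W_def D_def using init by simp
  ultimately have "W b \<le> 0" by (simp add: mult_le_0_iff)
  moreover have "0 \<le> W b" unfolding W_def by (intro sum_nonneg) auto
  ultimately have "W b = 0" by simp
  then have "D k b = 0" if "k \<in> {1..int N}" for k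
    using that unfolding W_def by (subst (asm) sum_nonneg_eq_0_iff) auto
  then have "D ((k - 1) mod int N + 1) b = 0"
    using mod_plus_one_in_period[of "int N" k] \<open>0 < N\<close> by simp
  then show ?thesis
    using periodic_reduce[of "\<lambda>k. D k b" "int N" k] per[of b] \<open>0 \<le> b\<close> by (simp add: D_def)
qed

section \<open>Global existence for the truncated system\<close>

instance bcontfun :: (metric_space, banach) banach ..

text \<open>
  The state space consists of the bounded functions on \<open>\<int>\<close> with the supremum norm; the wrapper
  \<open>discrete\<close> only supplies the metric space structure that \<open>bcontfun\<close> requires of its domain. Reading
  all indices modulo \<open>N\<close> gives periodicity for free.
\<close>

lemma lattice_global_solution:
  fixes w :: "int \<Rightarrow> real"
  assumes "0 < N" "0 < h" "0 < \<epsilon>" and w: "\<And>k. w (k + int N) = w k"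
    and lip: "\<And>x y. \<bar>\<phi> x - \<phi> y\<bar> \<le> \<bar>x - y\<bar>" and M: "\<And>x. \<bar>\<phi> x\<bar> \<le> M"
  obtains U where "\<And>k t. U (k + int N) t = U k t" "\<And>k. U k 0 = w k"
    "\<And>k t. 0 \<le> t \<Longrightarrow> (U k has_real_derivative
        lattice_rhs h \<epsilon> \<phi> (U (k - 1) t) (U k t) (U (k + 1) t)) (at t within {0..})"
proof -
  define r :: "int \<Rightarrow> int discrete" where "r k = discrete (k mod int N)" for k
  define K where "K = M / h + 2 * \<epsilon> / h\<^sup>2"
  have "0 \<le> M" using M[of 0] by simp
  then have K: "0 \<le> K" using \<open>0 < h\<close> \<open>0 < \<epsilon>\<close> by (simp add: K_def)
  define F where "F u i = lattice_rhs h \<epsilon> \<phi> (apply_bcontfun u (r (of_discrete i - 1)))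
      (apply_bcontfun u (r (of_discrete i))) (apply_bcontfun u (r (of_discrete i + 1)))"
    for u :: "int discrete \<Rightarrow>\<^sub>C real" and i :: "int discrete"
  have F_diff: "\<bar>F u i - F v i\<bar> \<le> 3 * K * norm (u - v)" for u v i
  proof -
    have d: "\<bar>apply_bcontfun u j - apply_bcontfun v j\<bar> \<le> norm (u - v)" for j
      using norm_bounded[of "u - v" j] by simp
    have "\<bar>F u i - F v i\<bar> \<le> K * (\<bar>apply_bcontfun u (r (of_discrete i - 1)) - apply_bcontfun v (r (of_discrete i - 1))\<bar>
        + \<bar>apply_bcontfun u (r (of_discrete i)) - apply_bcontfun v (r (of_discrete i))\<bar>
        + \<bar>apply_bcontfun u (r (of_discrete i + 1)) - apply_bcontfun v (r (of_discrete i + 1))\<bar>)"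
      unfolding F_def K_def using \<open>0 < h\<close> \<open>0 < \<epsilon>\<close> lip M M M by (rule lattice_rhs_diff_le)
    also have "\<dots> \<le> K * (norm (u - v) + norm (u - v) + norm (u - v))"
      by (intro mult_left_mono add_mono d K)
    finally show ?thesis by simp
  qed
  \<comment> \<open>Every function on a discrete space is continuous, so membership in
    \<open>bcontfun\<close> is a matter of boundedness.\<close>
  have cont: "continuous_on UNIV a" for a :: "int discrete \<Rightarrow> real"
    by (simp add: continuous_on_open_vimage open_discrete)
  have "F u \<in> bcontfun" for u
  proof (rule bcontfun_normI[OF cont])
    \<comment> \<open>The right-hand side vanishes at the zero state for any \<phi>, so the
      Lipschitz estimate against \<open>0\<close> bounds \<open>F u\<close>.\<close>
    show "norm (F u i) \<le> 3 * K * norm u" for i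
      using F_diff[of u i 0] by (simp add: F_def lattice_rhs_def)
  qed
  then have F_apply: "apply_bcontfun (Bcontfun (F u)) = F u" for u
    by (simp add: Bcontfun_inverse)
  define x0 where "x0 = Bcontfun (\<lambda>i :: int discrete. w (of_discrete i mod int N))"
  have "(3 * K)-lipschitz_on UNIV (\<lambda>u. Bcontfun (F u))"
  proof (rule lipschitz_onI)
    fix u v
    show "dist (Bcontfun (F u)) (Bcontfun (F v)) \<le> 3 * K * dist u v"
      using F_diff by (intro dist_bound) (simp add: F_apply dist_norm)
  qed (use K in simp)
  then obtain x where x0: "x 0 = x0"
    and x: "\<And>t. 0 \<le> t \<Longrightarrow> (x has_vector_derivative Bcontfun (F (x t))) (at t within {0..})"
    by (rule lipschitz_imp_global_solution[where a = x0]) (rule that)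
  have "(\<lambda>i. w (of_discrete i mod int N)) \<in> bcontfun"
  proof (rule bcontfun_normI[OF cont])
    fix i :: "int discrete"
    show "norm (w (of_discrete i mod int N)) \<le> (\<Sum>k\<in>{0..<int N}. \<bar>w k\<bar>)"
      using \<open>0 < N\<close> by (auto intro!: member_le_sum)
  qed
  then have x0_apply: "apply_bcontfun x0 i = w (of_discrete i mod int N)" for i
    by (simp add: x0_def Bcontfun_inverse)
  \<comment> \<open>Evaluation at an index is bounded linear, which turns the derivative in the
    supremum norm into derivatives of the coordinates.\<close>
  have lin: "bounded_linear (\<lambda>u. apply_bcontfun u i)" for i :: "int discrete"
    by (rule bounded_linear_intro[where K = 1]) (auto simp: norm_bounded[simplified])
  define U where "U k t = apply_bcontfun (x t) (r k)" for k t
  show thesis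
  proof
    show "U (k + int N) t = U k t" for k t by (simp add: U_def r_def)
    show "U k 0 = w k" for k
      using periodic_mod[of w "int N" k] w by (simp add: U_def x0 x0_apply r_def discrete_inverse)
    fix k and t :: real assume "0 \<le> t"
    have "F (x t) (r k) = lattice_rhs h \<epsilon> \<phi> (U (k - 1) t) (U k t) (U (k + 1) t)"
      by (simp add: F_def U_def r_def discrete_inverse mod_simps)
    then show "(U k has_real_derivative lattice_rhs h \<epsilon> \<phi> (U (k - 1) t) (U k t) (U (k + 1) t)) (at t within {0..})"
      using bounded_linear.has_vector_derivative[OF lin x[OF \<open>0 \<le> t\<close>], of "r k"]
      by (simp add: U_def[abs_def] F_apply has_real_derivative_iff_has_vector_derivative)
  qed
qed

section \<open>Truncation, conservation and positivity\<close>

text \<open>For \<open>0 \<le> S\<close> this is the nearest-point projection onto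
  \<open>{0..S}\<close>: bounded, 1-Lipschitz, and the identity on the range occupied by positive
  solutions with sum \<open>S\<close>.\<close>

definition clip :: "real \<Rightarrow> real \<Rightarrow> real" where
  "clip S x = max 0 (min S x)"

lemma abs_clip_diff_le: "\<bar>clip S x - clip S y\<bar> \<le> \<bar>x - y\<bar>"
  by (auto simp: clip_def max_def min_def)

lemma abs_clip_le: "0 \<le> S \<Longrightarrow> \<bar>clip S x\<bar> \<le> S"
  by (auto simp: clip_def)

lemma lattice_rhs_clip:
  assumes "a \<in> {0..S}" "b \<in> {0..S}" "c \<in> {0..S}"
  shows "lattice_rhs h \<epsilon> (clip S) a b c = lattice_rhs h \<epsilon> (\<lambda>x. x) a b c"
  using assms by (simp add: lattice_rhs_def clip_def)

lemma periodic_le_sum: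
  fixes u :: "int \<Rightarrow> real"
  assumes "0 < N" "\<And>k. u (k + int N) = u k" "\<And>k. 0 < u k"
  shows "u k \<le> (\<Sum>k\<in>{1..int N}. u k)"
proof -
  have "u ((k - 1) mod int N + 1) \<le> (\<Sum>k\<in>{1..int N}. u k)"
    using \<open>0 < N\<close> assms(3) by (intro member_le_sum mod_plus_one_in_period) (auto simp: less_imp_le)
  then show ?thesis using periodic_reduce[of u "int N" k] assms(2) by simp
qed

text \<open>Kept general in \<phi>: positivity uses it for the truncated system, convergence for the
  original one.\<close>

lemma sum_lattice_conserved:
  assumes per: "\<And>k t. U (k + int N) t = U k t"
    and deriv: "\<And>k t. 0 \<le> t \<Longrightarrow> (U k has_real_derivative
        lattice_rhs h \<epsilon> \<phi> (U (k - 1) t) (U k t) (U (k + 1) t)) (at t within {0..})"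
    and "0 \<le> t"
  shows "(\<Sum>k\<in>{1..int N}. U k t) = (\<Sum>k\<in>{1..int N}. U k 0)"
proof -
  have "((\<lambda>t. \<Sum>k\<in>{1..int N}. U k t) has_real_derivative 0) (at s within {0..})" if "0 \<le> s" for s
  proof -
    have "((\<lambda>t. \<Sum>k\<in>{1..int N}. U k t) has_real_derivative
        (\<Sum>k\<in>{1..int N}. lattice_rhs h \<epsilon> \<phi> (U (k - 1) s) (U k s) (U (k + 1) s))) (at s within {0..})"
      by (intro DERIV_sum deriv that)
    then show ?thesis using sum_lattice_rhs[of "\<lambda>k. U k s" N h \<epsilon> \<phi>] per by simp
  qed
  then obtain c where "\<And>s. s \<in> {0..} \<Longrightarrow> (\<Sum>k\<in>{1..int N}. U k s) = c"
    using has_field_derivative_zero_constant[of "{0..}" "\<lambda>t. \<Sum>k\<in>{1..int N}. U k t"] by auto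
  with \<open>0 \<le> t\<close> show ?thesis by simp
qed

text \<open>\<open>J\<close> is left free: it is \<open>{0..b}\<close> for the growth of the product
  and \<open>{0..}\<close> for convergence.\<close>

lemma sum_ln_lattice_derivative:
  assumes per: "\<And>k. U (k + int N) t = U k t" and pos: "\<And>k. 0 < U k t" and "0 < h"
    and deriv: "\<And>k. k \<in> {1..int N} \<Longrightarrow> (U k has_real_derivative
        lattice_rhs h \<epsilon> (\<lambda>x. x) (U (k - 1) t) (U k t) (U (k + 1) t)) (at t within J)"
  shows "((\<lambda>t. \<Sum>k\<in>{1..int N}. ln (U k t)) has_real_derivative
    \<epsilon> / h\<^sup>2 * (\<Sum>k\<in>{1..int N}. (U (k + 1) t - U k t)\<^sup>2 / (U k t * U (k + 1) t))) (at t within J)"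
proof -
  have "((\<lambda>t. \<Sum>k\<in>{1..int N}. ln (U k t)) has_real_derivative
      (\<Sum>k\<in>{1..int N}. lattice_rhs h \<epsilon> (\<lambda>x. x) (U (k - 1) t) (U k t) (U (k + 1) t) / U k t)) (at t within J)"
    using pos by (auto intro!: derivative_eq_intros deriv sum.cong simp: field_simps)
  then show ?thesis
    using sum_lattice_rhs_divide[of "\<lambda>k. U k t" N h \<epsilon>] per pos \<open>0 < h\<close> by simp
qed

text \<open>Stated on a bounded interval, because the positivity proof applies it up to a first
  critical time, before positivity for all times is known.\<close>

lemma prod_lattice_mono:
  assumes "0 < h" "0 < \<epsilon>" "0 \<le> b" and per: "\<And>k t. U (k + int N) t = U k t"
    and pos: "\<And>k t. t \<in> {0..b} \<Longrightarrow> 0 < U k t"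
    and deriv: "\<And>k t. t \<in> {0..b} \<Longrightarrow> (U k has_real_derivative
        lattice_rhs h \<epsilon> (\<lambda>x. x) (U (k - 1) t) (U k t) (U (k + 1) t)) (at t within {0..b})"
  shows "(\<Prod>k\<in>{1..int N}. U k 0) \<le> (\<Prod>k\<in>{1..int N}. U k b)"
proof -
  have "0 * (b - 0) \<le> (\<Sum>k\<in>{1..int N}. ln (U k b)) - (\<Sum>k\<in>{1..int N}. ln (U k 0))"
  proof (rule increment_ge_of_derivative_ge[OF \<open>0 \<le> b\<close> sum_ln_lattice_derivative[OF per pos \<open>0 < h\<close> deriv]])
    fix t assume "t \<in> {0..b}"
    then show "0 \<le> \<epsilon> / h\<^sup>2 * (\<Sum>k\<in>{1..int N}. (U (k + 1) t - U k t)\<^sup>2 / (U k t * U (k + 1) t))"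
      using \<open>0 < \<epsilon>\<close> pos by (intro mult_nonneg_nonneg sum_nonneg divide_nonneg_nonneg) (auto simp: less_imp_le)
  qed
  moreover have "ln (\<Prod>k\<in>{1..int N}. U k t) = (\<Sum>k\<in>{1..int N}. ln (U k t))"
    "0 < (\<Prod>k\<in>{1..int N}. U k t)" if "t \<in> {0..b}" for t
    using pos[OF that] by (auto intro!: ln_prod prod_pos simp: less_imp_neq[THEN not_sym])
  ultimately show ?thesis
    using \<open>0 \<le> b\<close> ln_le_cancel_iff[of "\<Prod>k\<in>{1..int N}. U k 0" "\<Prod>k\<in>{1..int N}. U k b"] by simp
qed

text \<open>Positivity up to time \<open>b\<close> improves itself to the uniform bound \<delta> at
  \<open>b\<close>. At the first time some entry is down to \<delta>/2, all entries have been
  positive so far, hence are at least \<delta>: a contradiction.\<close>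

lemma clipped_lattice_positive:
  assumes "0 < N" "0 < h" "0 < \<epsilon>" and per: "\<And>k t. U (k + int N) t = U k t"
    and deriv: "\<And>k t. 0 \<le> t \<Longrightarrow> (U k has_real_derivative
        lattice_rhs h \<epsilon> (clip (\<Sum>k\<in>{1..int N}. U k 0)) (U (k - 1) t) (U k t) (U (k + 1) t)) (at t within {0..})"
    and init: "\<And>k. 0 < U k 0" and "0 \<le> t"
  shows "0 < U k t"
proof -
  define S where "S = (\<Sum>k\<in>{1..int N}. U k 0)"
  define p where "p = (\<Prod>k\<in>{1..int N}. U k 0)"
  \<comment> \<open>The bound extracted from \<open>p \<le> U k b * S ^ (N - 1)\<close>.\<close>
  define \<delta> where "\<delta> = p / S ^ (N - 1)"
  have S: "0 < S" unfolding S_def using init \<open>0 < N\<close> by (intro sum_pos) auto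
  have \<delta>: "0 < \<delta>" unfolding \<delta>_def p_def using init S by (intro divide_pos_pos prod_pos) auto
  note deriv = deriv[folded S_def]
  have sum: "(\<Sum>k\<in>{1..int N}. U k t) = S" if "0 \<le> t" for t
    using sum_lattice_conserved[OF per deriv that] by (simp add: S_def)
  have cont: "continuous_on J (U k)" if "J \<subseteq> {0..}" for J k
    using that by (intro continuous_on_subset[OF DERIV_continuous_on[OF deriv]]) auto
  have ge_\<delta>: "\<delta> \<le> U k b"
    if "0 \<le> b" and pos: "\<And>k t. t \<in> {0..b} \<Longrightarrow> 0 < U k t" and k: "k \<in> {1..int N}" for b k
  proof -
    have "p \<le> (\<Prod>k\<in>{1..int N}. U k b)"
      unfolding p_def
    proof (rule prod_lattice_mono[of h \<epsilon> b U N, OF \<open>0 < h\<close> \<open>0 < \<epsilon>\<close> \<open>0 \<le> b\<close> per pos])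
      fix k t assume t: "t \<in> {0..b}"
      \<comment> \<open>Positive entries with sum \<open>S\<close> lie in \<open>{0..S}\<close>,
        where the truncation is inactive.\<close>
      have "U j t \<in> {0..S}" for j
        using periodic_le_sum[of N "\<lambda>k. U k t" j] \<open>0 < N\<close> per pos[OF t] sum[of t] t
        by (auto simp: less_imp_le)
      then show "(U k has_real_derivative lattice_rhs h \<epsilon> (\<lambda>x. x) (U (k - 1) t) (U k t) (U (k + 1) t))
          (at t within {0..b})"
        using t has_field_derivative_subset[OF deriv[of t k], of "{0..b}"] by (auto simp: lattice_rhs_clip)
    qed
    also have "\<dots> \<le> U k b * S ^ (N - 1)"
      using prod_le_mult_sum_power[of "{1..int N}" k "\<lambda>k. U k b"] k pos \<open>0 \<le> b\<close> sum[of b]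
      by (auto simp: less_imp_le)
    finally show ?thesis using S by (simp add: \<delta>_def field_simps)
  qed
  have above: "\<delta> / 2 < U k t" if "0 \<le> t" "k \<in> {1..int N}" for k t
  proof (rule ccontr)
    assume "\<not> \<delta> / 2 < U k t"
    \<comment> \<open>The times at which some entry is at most \<delta>/2. \<open>Z\<close> is
      compact, so a first such time \<open>b\<close> exists.\<close>
    define Z where "Z = (\<Union>k\<in>{1..int N}. {s \<in> {0..t}. U k s \<le> \<delta> / 2})"
    have "closed {s \<in> {0..t}. U k s \<le> \<delta> / 2}" for k
      by (rule continuous_on_closed_Collect_le[OF cont continuous_on_const]) auto
    then have "compact Z" unfolding Z_def
      by (intro compact_UN) (auto simp: compact_eq_bounded_closed intro: bounded_subset[of "{0..t}"])
    moreover have "t \<in> Z" using \<open>\<not> \<delta> / 2 < U k t\<close> that by (force simp: Z_def not_less)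
    ultimately obtain b where "b \<in> Z" and min: "\<And>s. s \<in> Z \<Longrightarrow> b \<le> s"
      using compact_attains_inf[of Z] by blast
    then obtain j where j: "j \<in> {1..int N}" "0 \<le> b" "b \<le> t" "U j b \<le> \<delta> / 2"
      by (auto simp: Z_def)
    have before: "\<delta> / 2 < U i s" if "i \<in> {1..int N}" "0 \<le> s" "s < b" for i s
      using min[of s] that j by (force simp: Z_def)
    \<comment> \<open>An entry strictly below \<delta>/2 at \<open>b\<close> would have crossed that
      level earlier, contradicting the choice of \<open>b\<close>.\<close>
    have at_b: "\<delta> / 2 \<le> U i b" if i: "i \<in> {1..int N}" for i
    proof (rule ccontr)
      assume "\<not> \<delta> / 2 \<le> U i b"
      moreover have "\<delta> \<le> U i 0" using ge_\<delta>[of 0 i] init i by simp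
      ultimately obtain s where "0 \<le> s" "s \<le> b" "U i s = \<delta> / 2"
        using IVT2'[of "U i" b "\<delta> / 2" 0] cont[of "{0..b}" i] \<open>0 \<le> b\<close> \<delta> by auto
      with before[OF i, of s] \<open>\<not> \<delta> / 2 \<le> U i b\<close> show False by (cases "s = b") auto
    qed
    have "0 < U i s" if "s \<in> {0..b}" for i s
    proof -
      have "\<delta> / 2 \<le> U ((i - 1) mod int N + 1) s"
        using before at_b mod_plus_one_in_period[of "int N" i] \<open>0 < N\<close> that
        by (cases "s = b") (auto simp: less_imp_le)
      then show ?thesis
        using periodic_reduce[of "\<lambda>k. U k s" "int N" i] per \<delta> by simp
    qed
    then have "\<delta> \<le> U j b" using j by (intro ge_\<delta>) auto
    with j \<delta> show False by simp
  qed
  show ?thesis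
    using above[OF \<open>0 \<le> t\<close> mod_plus_one_in_period[of "int N" k]] \<open>0 < N\<close> \<delta>
      periodic_reduce[of "\<lambda>k. U k t" "int N" k] per by simp
qed

section \<open>Convergence to the mean\<close>

text \<open>Comparison with the zero state, where the right-hand side vanishes. The bound controls
  the slope of \<open>Q\<close> in the Barbalat argument.\<close>

lemma abs_lattice_rhs_le:
  assumes "0 < h" "0 < \<epsilon>" and abc: "a \<in> {0..S}" "b \<in> {0..S}" "c \<in> {0..S}"
  shows "\<bar>lattice_rhs h \<epsilon> (\<lambda>x. x) a b c\<bar> \<le> (S / h + 2 * \<epsilon> / h\<^sup>2) * (3 * S)"
proof -
  have S: "0 \<le> S" using abc by auto
  have "\<bar>lattice_rhs h \<epsilon> (\<lambda>x. x) a b c - lattice_rhs h \<epsilon> (\<lambda>x. x) 0 0 0\<bar>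
      \<le> (S / h + 2 * \<epsilon> / h\<^sup>2) * (\<bar>a - 0\<bar> + \<bar>b - 0\<bar> + \<bar>c - 0\<bar>)"
    using assms S by (intro lattice_rhs_diff_le) auto
  also have "\<dots> \<le> (S / h + 2 * \<epsilon> / h\<^sup>2) * (3 * S)"
    using assms S by (intro mult_left_mono) auto
  finally show ?thesis by (simp add: lattice_rhs_def)
qed

text \<open>Barbalat's argument with the sum of logarithms as \<open>G\<close> and the sum of
  squared steps as \<open>Q\<close>. All entries are at most \<open>S\<close>, so the denominators
  in the derivative of \<open>G\<close> are at most \<open>S\<^sup>2\<close>, and \<open>G\<close>
  is at most \<open>N * ln S\<close>.\<close>

lemma lattice_converges:
  assumes "0 < N" "0 < h" "0 < \<epsilon>" and per: "\<And>k t. U (k + int N) t = U k t"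
    and deriv: "\<And>k t. 0 \<le> t \<Longrightarrow> (U k has_real_derivative
        lattice_rhs h \<epsilon> (\<lambda>x. x) (U (k - 1) t) (U k t) (U (k + 1) t)) (at t within {0..})"
    and pos: "\<And>k t. 0 \<le> t \<Longrightarrow> 0 < U k t"
  shows "(U k \<longlongrightarrow> (\<Sum>k\<in>{1..int N}. U k 0) / N) at_top"
proof -
  let ?A = "{1..int N}"
  define S where "S = (\<Sum>k\<in>?A. U k 0)"
  have sum: "(\<Sum>k\<in>?A. U k t) = S" if "0 \<le> t" for t
    using sum_lattice_conserved[OF per deriv that] by (simp add: S_def)
  have S: "0 < S" unfolding S_def using pos \<open>0 < N\<close> by (intro sum_pos) auto
  have U_le: "U k t \<le> S" if "0 \<le> t" for k t
    using periodic_le_sum[of N "\<lambda>k. U k t" k] \<open>0 < N\<close> per pos[OF that] sum[OF that] by simp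
  have U_mem: "U k t \<in> {0..S}" if "0 \<le> t" for k t
    using U_le[OF that] pos[OF that] by (simp add: less_imp_le)
  define F where "F k t = lattice_rhs h \<epsilon> (\<lambda>x. x) (U (k - 1) t) (U k t) (U (k + 1) t)" for k t
  define R where "R = (S / h + 2 * \<epsilon> / h\<^sup>2) * (3 * S)"
  have R: "0 < R" using S \<open>0 < h\<close> \<open>0 < \<epsilon>\<close> by (simp add: R_def add_pos_pos)
  have F_le: "\<bar>F k t\<bar> \<le> R" if "0 \<le> t" for k t
    unfolding F_def R_def using U_mem[OF that] \<open>0 < h\<close> \<open>0 < \<epsilon>\<close> by (intro abs_lattice_rhs_le)
  define Q where "Q t = (\<Sum>k\<in>?A. (U (k + 1) t - U k t)\<^sup>2)" for t
  have "(Q \<longlongrightarrow> 0) at_top"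
  proof (rule barbalat_tendsto_zero)
    fix t :: real assume t: "0 \<le> t"
    note U = U_le[OF t] pos[OF t]
    show "((\<lambda>t. \<Sum>k\<in>?A. ln (U k t)) has_real_derivative
        \<epsilon> / h\<^sup>2 * (\<Sum>k\<in>?A. (U (k + 1) t - U k t)\<^sup>2 / (U k t * U (k + 1) t))) (at t within {0..})"
      using per pos[OF t] \<open>0 < h\<close> deriv[OF t] by (rule sum_ln_lattice_derivative)
    have "(\<Sum>k\<in>?A. (U (k + 1) t - U k t)\<^sup>2 / S\<^sup>2) \<le> (\<Sum>k\<in>?A. (U (k + 1) t - U k t)\<^sup>2 / (U k t * U (k + 1) t))"
      unfolding power2_eq_square[of S] using U S
      by (intro sum_mono divide_left_mono mult_mono mult_pos_pos) (auto simp: less_imp_le)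
    then have "\<epsilon> / h\<^sup>2 * (Q t / S\<^sup>2) \<le> \<epsilon> / h\<^sup>2 * (\<Sum>k\<in>?A. (U (k + 1) t - U k t)\<^sup>2 / (U k t * U (k + 1) t))"
      using \<open>0 < \<epsilon>\<close> by (intro mult_left_mono) (auto simp: Q_def sum_divide_distrib)
    then show "\<epsilon> / h\<^sup>2 / S\<^sup>2 * Q t \<le> \<epsilon> / h\<^sup>2 * (\<Sum>k\<in>?A. (U (k + 1) t - U k t)\<^sup>2 / (U k t * U (k + 1) t))"
      by simp
    show "(Q has_real_derivative (\<Sum>k\<in>?A. 2 * (U (k + 1) t - U k t) * (F (k + 1) t - F k t))) (at t within {0..})"
      unfolding Q_def F_def using t
      by (auto intro!: derivative_eq_intros deriv sum.cong simp: algebra_simps)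
    show "0 \<le> Q t" unfolding Q_def by (intro sum_nonneg) auto
    have "\<bar>\<Sum>k\<in>?A. 2 * (U (k + 1) t - U k t) * (F (k + 1) t - F k t)\<bar> \<le> (\<Sum>k\<in>?A. (2 * S) * (2 * R))"
    proof (rule order_trans[OF sum_abs sum_mono])
      fix k
      have "\<bar>U (k + 1) t - U k t\<bar> \<le> S" using U(1)[of k] U(1)[of "k + 1"] U(2)[of k] U(2)[of "k + 1"] by linarith
      moreover have "\<bar>F (k + 1) t - F k t\<bar> \<le> 2 * R" using F_le[OF t, of k] F_le[OF t, of "k + 1"] by linarith
      ultimately show "\<bar>2 * (U (k + 1) t - U k t) * (F (k + 1) t - F k t)\<bar> \<le> (2 * S) * (2 * R)"
        unfolding abs_mult using S by (intro mult_mono) auto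
    qed
    then show "- (N * (2 * S * (2 * R))) \<le> (\<Sum>k\<in>?A. 2 * (U (k + 1) t - U k t) * (F (k + 1) t - F k t))"
      by simp
    show "(\<Sum>k\<in>?A. ln (U k t)) \<le> (\<Sum>k\<in>?A. ln S)"
      using U S by (intro sum_mono) simp
  qed (use S R \<open>0 < N\<close> \<open>0 < h\<close> \<open>0 < \<epsilon>\<close> in auto)
  then have sqrt_Q: "((\<lambda>t. sqrt (Q t)) \<longlongrightarrow> 0) at_top"
    using tendsto_real_sqrt by fastforce
  have step: "((\<lambda>t. U (k + 1) t - U k t) \<longlongrightarrow> 0) at_top" if "k \<in> ?A" for k
  proof (rule Lim_null_comparison[OF _ sqrt_Q])
    have "(U (k + 1) t - U k t)\<^sup>2 \<le> Q t" for t
      unfolding Q_def using that member_le_sum[of k ?A "\<lambda>k. (U (k + 1) t - U k t)\<^sup>2"] by simp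
    then show "\<forall>\<^sub>F t in at_top. norm (U (k + 1) t - U k t) \<le> sqrt (Q t)"
      by (simp add: real_le_rsqrt)
  qed
  \<comment> \<open>Summing steps from site 1 to site \<open>1 + j\<close> shows that all
    differences to site 1 vanish in the limit.\<close>
  have diff: "((\<lambda>t. U (1 + int j) t - U 1 t) \<longlongrightarrow> 0) at_top" if "j < N" for j
    using that
  proof (induction j)
    case (Suc j)
    then have "((\<lambda>t. (U (1 + int j + 1) t - U (1 + int j) t) + (U (1 + int j) t - U 1 t)) \<longlongrightarrow> 0 + 0) at_top"
      by (intro tendsto_add step) auto
    then show ?case by (simp add: algebra_simps)
  qed simp
  have diff': "((\<lambda>t. U k t - U 1 t) \<longlongrightarrow> 0) at_top" if "k \<in> ?A" for k
    using diff[of "nat (k - 1)"] that by (simp add: nat_less_iff)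
  \<comment> \<open>The conserved sum is solved for \<open>U 1 t\<close>, which leaves only the
    vanishing differences.\<close>
  have "((\<lambda>t. (S - (\<Sum>k\<in>?A. U k t - U 1 t)) / N) \<longlongrightarrow> (S - (\<Sum>k\<in>?A. 0)) / N) at_top"
    using \<open>0 < N\<close> by (intro tendsto_intros diff') auto
  moreover have "\<forall>\<^sub>F t in at_top. (S - (\<Sum>k\<in>?A. U k t - U 1 t)) / N = U 1 t"
    using eventually_ge_at_top[of 0]
    by eventually_elim (use \<open>0 < N\<close> in \<open>simp add: sum_subtractf sum\<close>)
  ultimately have U1: "(U 1 \<longlongrightarrow> S / N) at_top"
    using Lim_transform_eventually by fastforce
  have "((\<lambda>t. (U ((k - 1) mod int N + 1) t - U 1 t) + U 1 t) \<longlongrightarrow> 0 + S / N) at_top"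
    using \<open>0 < N\<close> by (intro tendsto_add U1 diff' mod_plus_one_in_period) simp
  moreover have "U ((k - 1) mod int N + 1) t = U k t" for t
    using periodic_reduce[of "\<lambda>k. U k t" "int N" k] per by simp
  ultimately show ?thesis by (simp add: S_def)
qed

section \<open>From the truncated system back to the original one\<close>

theorem proposition4p1:
  fixes N :: nat and h \<epsilon> :: real and u0 :: "int \<Rightarrow> real"
  assumes "N \<ge> 1" and "h > 0" and "\<epsilon> > 0"
    and "\<forall>k\<in>{1..int N}. u0 k > 0"
  shows "\<exists>U. solves_ivp N h \<epsilon> u0 {0..} U \<and>
    (\<forall>J V. is_interval J \<and> 0 \<in> J \<and> J \<subseteq> {0..} \<and> solves_ivp N h \<epsilon> u0 J V \<longrightarrow>
        (\<forall>k. \<forall>t\<in>J. V k t = U k t)) \<and>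
    (\<forall>k\<in>{1..int N}. \<forall>t\<ge>0. U k t > 0) \<and>
    (\<forall>t\<ge>0. (\<Prod>k\<in>{1..int N}. U k t) \<ge> (\<Prod>k\<in>{1..int N}. U k 0)) \<and>
    (\<exists>c. \<forall>k\<in>{1..int N}. (U k \<longlongrightarrow> c) at_top)"
proof -
  have N: "0 < N" using assms(1) by simp
  \<comment> \<open>\<open>u0\<close> is prescribed on \<open>{1..int N}\<close> alone and arbitrary
    elsewhere; \<open>w\<close> is its periodic extension.\<close>
  define w where "w k = u0 ((k - 1) mod int N + 1)" for k
  have w_per: "w (k + int N) = w k" for k
    using mod_add_self2[of "k - 1" "int N"] by (simp add: w_def algebra_simps)
  have w_eq: "w k = u0 k" if "k \<in> {1..int N}" for k
    using that by (simp add: w_def)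
  have w_pos: "0 < w k" for k
    using assms(4) mod_plus_one_in_period[of "int N" k] N by (simp add: w_def)
  define S where "S = (\<Sum>k\<in>{1..int N}. w k)"
  have "0 \<le> S" unfolding S_def using w_pos by (intro sum_nonneg) (simp add: less_imp_le)
  obtain U where per: "\<And>k t. U (k + int N) t = U k t" and init: "\<And>k. U k 0 = w k"
    and clip_deriv: "\<And>k t. 0 \<le> t \<Longrightarrow> (U k has_real_derivative
        lattice_rhs h \<epsilon> (clip S) (U (k - 1) t) (U k t) (U (k + 1) t)) (at t within {0..})"
    using lattice_global_solution[of N h \<epsilon> w "clip S" S,
        OF N assms(2,3) w_per abs_clip_diff_le abs_clip_le[OF \<open>0 \<le> S\<close>]] by blast
  have S_eq: "S = (\<Sum>k\<in>{1..int N}. U k 0)" by (simp add: S_def init)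
  have pos: "0 < U k t" if "0 \<le> t" for k t
    using N assms(2,3) per clip_deriv[unfolded S_eq] _ that
    by (rule clipped_lattice_positive) (auto simp: init w_pos)
  \<comment> \<open>Positivity and the conserved sum confine the solution to \<open>{0..S}\<close>,
    so the truncated equations are the original ones.\<close>
  have mem: "U k t \<in> {0..S}" if "0 \<le> t" for k t
    using periodic_le_sum[of N "\<lambda>k. U k t" k] N per pos[OF that]
      sum_lattice_conserved[OF per clip_deriv that] by (simp add: S_eq less_imp_le)
  have deriv: "(U k has_real_derivative
      lattice_rhs h \<epsilon> (\<lambda>x. x) (U (k - 1) t) (U k t) (U (k + 1) t)) (at t within {0..})"
    if "0 \<le> t" for k t
    using clip_deriv[OF that] mem[OF that] by (simp add: lattice_rhs_clip)
  have sol: "solves_system N h \<epsilon> {0..} U"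
    unfolding solves_system_iff using per deriv by simp
  have "\<forall>J V. is_interval J \<and> 0 \<in> J \<and> J \<subseteq> {0..} \<and> solves_ivp N h \<epsilon> u0 J V \<longrightarrow>
      (\<forall>k. \<forall>t\<in>J. V k t = U k t)"
  proof (intro allI impI ballI)
    fix J V k t
    assume *: "is_interval J \<and> 0 \<in> J \<and> J \<subseteq> {0..} \<and> solves_ivp N h \<epsilon> u0 J V" and t: "t \<in> J"
    \<comment> \<open>An interval containing 0 and \<open>t\<close> contains \<open>{0..t}\<close>,
      so uniqueness on compact intervals covers solutions on any \<open>J\<close>.\<close>
    have sub: "{0..t} \<subseteq> J" using mem_is_interval_1_I[of J 0 t] * t by auto
    have "0 \<le> t" using * t by auto
    have V_sol: "solves_system N h \<epsilon> J V" and V_init: "\<And>k. k \<in> {1..int N} \<Longrightarrow> V k 0 = U k 0"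
      using * init w_eq by (simp_all add: solves_ivp_def)
    have "solves_system N h \<epsilon> {0..t} U" by (rule solves_system_subset[OF sol]) simp
    then show "V k t = U k t"
      by (intro solves_system_unique[of N h \<epsilon> t V U] N assms(2,3) \<open>0 \<le> t\<close> V_init
          solves_system_subset[OF V_sol sub])
  qed
  moreover have "(\<Prod>k\<in>{1..int N}. U k 0) \<le> (\<Prod>k\<in>{1..int N}. U k t)" if "0 \<le> t" for t
    using that
    by (intro prod_lattice_mono[of h \<epsilon> t U N, OF assms(2,3) _ per pos]
        has_field_derivative_subset[OF deriv]) auto
  moreover have "solves_ivp N h \<epsilon> u0 {0..} U"
    using sol init w_eq by (simp add: solves_ivp_def)
  moreover have "\<exists>c. \<forall>k\<in>{1..int N}. (U k \<longlongrightarrow> c) at_top"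
    using lattice_converges[OF N assms(2,3) per deriv pos] by auto
  ultimately show ?thesis
    using pos by (intro exI[of _ U] conjI) simp_all
qed

end
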